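(* Let $d\ge 4$ and let $I=\{2^{i} : 0\le i\le d-1\}\cup\{d,\,2d-2,\,3d-5,\,3d-4\}$. Then $\{1,2,\dots,4d-10\}\setminus I$ is the set of first gaps of the $d$-dimensional hypercube $Q_d$; that is, an integer $m$ with $1\le m\le 4d-10$ is a gap of $Q_d$ if and only if $m\notin I$.
   Context: $Q_d$ is the convex hull of the $2^d$ points of $\mathbb{R}^d$ all of whose coordinates are $0$ or $1$. For a $d$-dimensional convex polytope $P\subset\mathbb{R}^d$, let $\mathcal{H}_P$ be the set of affine hyperplanes $H$ with $H\cap P\neq\emptyset$, let $cv_P(H)=|V(H\cap P)|$ be the number of vertices of $H\cap P$, and $\nu(P)=\max_{H\in\mathcal{H}_P}cv_P(H)$. A gap of $P$ is an integer $m$ with $1\le m\le\nu(P)$ that is not of the form $cv_P(H)$ for any $H\in\mathcal{H}_P$. *)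

theory Defs
  imports "HOL-Analysis.Analysis"
begin

definition hypercube :: "(real ^ 'n) set" where
  "hypercube = convex hull {x. \<forall>i. x $ i = 0 \<or> x $ i = 1}"

definition affine_hyperplane :: "'a::euclidean_space set \<Rightarrow> bool" where
  "affine_hyperplane H \<longleftrightarrow> (\<exists>a b. a \<noteq> 0 \<and> H = {x. a \<bullet> x = b})"

definition meeting_hyperplanes :: "'a::euclidean_space set \<Rightarrow> 'a set set" where
  "meeting_hyperplanes P = {H. affine_hyperplane H \<and> H \<inter> P \<noteq> {}}"

(* The vertices of the polytope H \<inter> P are its extreme points. *)
definition cv :: "'a::euclidean_space set \<Rightarrow> 'a set \<Rightarrow> nat" where
  "cv P H = card {v. v extreme_point_of (H \<inter> P)}"

(* For a nonempty polytope P the set below is finite and nonempty: a vertex of H \<inter> P is the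
   only point of H in some face of P, so cv P H is at most the number of faces of P. *)
definition nu :: "'a::euclidean_space set \<Rightarrow> nat" where
  "nu P = Max (cv P ` meeting_hyperplanes P)"

definition is_gap :: "'a::euclidean_space set \<Rightarrow> nat \<Rightarrow> bool" where
  "is_gap P m \<longleftrightarrow> 1 \<le> m \<and> m \<le> nu P \<and> \<not> (\<exists>H \<in> meeting_hyperplanes P. m = cv P H)"

end

theory Submission
  imports Defs
begin

text \<open>
  A vertex of the section of the cube by the hyperplane \<open>a \<bullet> x = b\<close> is either a cube vertex on
  the hyperplane or an interior point of a cube edge whose end points lie strictly on different
  sides (lemma \<open>cv_hypercube\<close>). Identifying cube vertices with sets \<open>S\<close> of coordinates, the
  number of vertices becomes a count \<open>section_count\<close> of sets of weight exactly \<open>b\<close> and of pairs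
  \<open>(S, insert i S)\<close> whose weights lie on different sides of \<open>b\<close>. The problem is to find the small
  values of this count.

  Slicing the cube by the two facets orthogonal to coordinate \<open>i\<close> writes the count as a sum of the
  counts of the two slices, which have levels \<open>b\<close> and \<open>b - w i\<close>, and of the number of edges in
  direction \<open>i\<close> that are crossed. This recursion shows that reflecting a coordinate changes
  nothing, so that weights may be taken nonnegative, that exchanging the level \<open>b\<close> for
  \<open>sum w A - b\<close> changes nothing, and that a coordinate of weight zero doubles the count.

  For \<open>n\<close> positive weights and a level strictly between \<open>0\<close> and the total weight, take
  for \<open>i\<close> a coordinate of least weight. If the neighbour in direction \<open>i\<close> of the
  vertex \<open>0\<close> does not lie strictly below the hyperplane, then no neighbour does, the vertex
  \<open>0\<close> is cut off as a corner, and the section has \<open>n\<close> vertices; the same holds at the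
  opposite vertex of the cube. Otherwise both slices are again nontrivial sections in dimension \<open>n -
  1\<close>. Hence every nontrivial section has at least \<open>n\<close> vertices, and one that is not a corner
  has at least \<open>2 n - 2\<close>. Iterating once more, with the observation that for enough coordinates the
  two slices cannot be corners at opposite ends, the next possible values are \<open>2 n - 2\<close> (only when
  an edge is cut off, if \<open>n \<ge> 5\<close>), then \<open>3 n - 5\<close>, \<open>3 n - 4\<close>, and
  then at least \<open>4 n - 9\<close>. For \<open>3 n - 5 + t\<close> one slice cuts off a corner and the other
  an edge; \<open>t\<close> is the number of crossed edges in direction \<open>i\<close>, and at most one edge
  can be crossed.

  With \<open>k\<close> zero weights these values are multiplied by \<open>2 ^ k\<close>, which adds only powers of two,
  \<open>2 d - 2\<close> and numbers that are at least \<open>4 d - 8\<close>. Explicit weights realise all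
  values in the list, as well as \<open>4 d - 8\<close>, so that \<open>nu\<close> exceeds the range considered.
\<close>

section \<open>Counting the vertices of a section combinatorially\<close>

text \<open>
  Sets \<open>S\<close> stand for the vertices of the cube of dimension \<open>card A\<close>, and pairs \<open>(S, i)\<close> with
  \<open>i \<notin> S\<close> for its edges. A negative product says that the end points of an edge are strictly
  separated by the hyperplane; no sign condition on the weights is built in, so that reflections
  of the cube can be applied.
\<close>

definition section_count :: "'a set \<Rightarrow> ('a \<Rightarrow> real) \<Rightarrow> real \<Rightarrow> nat" where
  "section_count A w b = card {S. S \<subseteq> A \<and> sum w S = b}
     + card {(S, i). S \<subseteq> A \<and> i \<in> A - S \<and> (sum w S - b) * (sum w (insert i S) - b) < 0}"

lemma finite_section_pairs:
  "finite A \<Longrightarrow> finite {(S, i). S \<subseteq> A \<and> i \<in> A - S \<and> P S i}"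
  by (rule finite_subset[of _ "Pow A \<times> A"]) auto

lemma section_count_empty: "section_count {} w b = (if b = 0 then 1 else 0)"
proof -
  have "{S::'a set. S \<subseteq> {} \<and> sum w S = b} = (if b = 0 then {{}} else {})" by auto
  then show ?thesis by (simp add: section_count_def)
qed

text \<open>
  The three terms are the two facets orthogonal to \<open>i\<close> and the edges in direction \<open>i\<close>. The facet
  containing \<open>i\<close> sees the level lowered by \<open>w i\<close>.
\<close>

lemma section_count_insert:
  assumes A: "finite A" and i: "i \<notin> A"
  shows "section_count (insert i A) w b = section_count A w b + section_count A w (b - w i)
     + card {S. S \<subseteq> A \<and> (sum w S - b) * (sum w S + w i - b) < 0}"
proof -
  let ?V = "\<lambda>A b. {S. S \<subseteq> A \<and> sum w S = b}"
  let ?E = "\<lambda>A b. {(S, j). S \<subseteq> A \<and> j \<in> A - S \<and> (sum w S - b) * (sum w (insert j S) - b) < 0}"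
  let ?C = "{S. S \<subseteq> A \<and> (sum w S - b) * (sum w S + w i - b) < 0}"
  let ?lift = "\<lambda>(S, j). (insert i S, j)"
  have sum_insert: "sum w (insert j S) = w j + sum w S" if "S \<subseteq> A" "j \<notin> S" for S j
    using that A finite_subset by (subst sum.insert) auto
  have sum_insert2: "sum w (insert j (insert i S)) = w i + sum w (insert j S)"
    if "S \<subseteq> A" "j \<in> A - S" for S j
  proof -
    have "finite (insert j S)" "i \<notin> insert j S" using that A i finite_subset by auto
    then have "sum w (insert i (insert j S)) = w i + sum w (insert j S)" by (rule sum.insert)
    then show ?thesis by (simp add: insert_commute)
  qed
  have inj: "inj_on (insert i) (Pow A)"
    using i by (auto simp: inj_on_def)
  have split: "T \<subseteq> insert i A \<longleftrightarrow> T \<subseteq> A \<or> (\<exists>S. S \<subseteq> A \<and> T = insert i S)" for T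
  proof
    assume T: "T \<subseteq> insert i A"
    then have "T - {i} \<subseteq> A" "i \<in> T \<Longrightarrow> T = insert i (T - {i})" "i \<notin> T \<Longrightarrow> T \<subseteq> A" by auto
    then show "T \<subseteq> A \<or> (\<exists>S. S \<subseteq> A \<and> T = insert i S)" by blast
  qed auto
  have "sum w (insert i S) = b \<longleftrightarrow> sum w S = b - w i" if "S \<subseteq> A" for S
  proof -
    have "sum w (insert i S) = w i + sum w S" using that i by (intro sum_insert) auto
    then show ?thesis by linarith
  qed
  then have V: "?V (insert i A) b = ?V A b \<union> insert i ` ?V A (b - w i)"
    by (auto simp only: split mem_Collect_eq Un_iff image_iff)
  have "card (?V (insert i A) b) = card (?V A b) + card (insert i ` ?V A (b - w i))"
    unfolding V using A i by (intro card_Un_disjoint) auto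
  also have "card (insert i ` ?V A (b - w i)) = card (?V A (b - w i))"
    by (rule card_image) (rule inj_on_subset[OF inj], auto)
  finally have cV: "card (?V (insert i A) b) = card (?V A b) + card (?V A (b - w i))" .
  have E: "?E (insert i A) b = (?E A b \<union> ?lift ` ?E A (b - w i)) \<union> (\<lambda>S. (S, i)) ` ?C"
  proof (intro set_eqI iffI)
    fix p assume "p \<in> ?E (insert i A) b"
    then obtain T j where p: "p = (T, j)" and T: "T \<subseteq> insert i A" "j \<in> insert i A - T"
      "(sum w T - b) * (sum w (insert j T) - b) < 0" by auto
    show "p \<in> (?E A b \<union> ?lift ` ?E A (b - w i)) \<union> (\<lambda>S. (S, i)) ` ?C"
    proof (cases "T \<subseteq> A")
      case True
      show ?thesis
      proof (cases "j = i")
        case j: True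
        have "sum w (insert j T) = sum w T + w i"
          using T True j sum_insert[of T i] by auto
        then have "T \<in> ?C" using T(3) True by simp
        then show ?thesis using p j by auto
      next
        case False
        then show ?thesis using p True T by auto
      qed
    next
      case False
      then obtain S where S: "S \<subseteq> A" "T = insert i S" using T split by auto
      have j: "j \<in> A - S" and "i \<notin> S" using S T i by auto
      then have "sum w T - b = sum w S - (b - w i)"
        "sum w (insert j T) - b = sum w (insert j S) - (b - w i)"
        using sum_insert[OF S(1), of i] sum_insert2[OF S(1) j] S(2) by auto
      then have "(sum w S - (b - w i)) * (sum w (insert j S) - (b - w i)) < 0"
        using T(3) by (simp only:)
      then have "(S, j) \<in> ?E A (b - w i)" using S(1) j by auto
      then show ?thesis using p S by force
    qed
  next
    fix p assume "p \<in> (?E A b \<union> ?lift ` ?E A (b - w i)) \<union> (\<lambda>S. (S, i)) ` ?C"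
    then consider (1) "p \<in> ?E A b" | (2) "p \<in> ?lift ` ?E A (b - w i)" | (3) "p \<in> (\<lambda>S. (S, i)) ` ?C" by blast
    then show "p \<in> ?E (insert i A) b"
    proof cases
      case 1 then show ?thesis by auto
    next
      case 2
      then obtain S j where S: "p = (insert i S, j)" "S \<subseteq> A" "j \<in> A - S"
        "(sum w S - (b - w i)) * (sum w (insert j S) - (b - w i)) < 0" by auto
      have "i \<notin> S" using S i by auto
      then have "sum w (insert i S) - b = sum w S - (b - w i)"
        "sum w (insert j (insert i S)) - b = sum w (insert j S) - (b - w i)"
        using sum_insert[OF S(2), of i] sum_insert2[OF S(2,3)] by auto
      then have "(sum w (insert i S) - b) * (sum w (insert j (insert i S)) - b) < 0"
        using S(4) by (simp only:)
      then show ?thesis using S i by auto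
    next
      case 3
      then obtain S where S: "p = (S, i)" "S \<subseteq> A" "(sum w S - b) * (sum w S + w i - b) < 0" by auto
      have "i \<notin> S" using S i by auto
      then have "sum w (insert i S) = sum w S + w i" using sum_insert[OF S(2), of i] by simp
      then show ?thesis using S i by auto
    qed
  qed
  have fin: "finite (?E A c)" for c by (rule finite_section_pairs[OF A])
  have finC: "finite ?C" using A by auto
  have "card (?E (insert i A) b) = card (?E A b \<union> ?lift ` ?E A (b - w i)) + card ((\<lambda>S. (S, i)) ` ?C)"
    unfolding E using fin finC i by (intro card_Un_disjoint finite_UnI finite_imageI) auto
  also have "card (?E A b \<union> ?lift ` ?E A (b - w i)) = card (?E A b) + card (?lift ` ?E A (b - w i))"
    using fin i by (intro card_Un_disjoint finite_imageI) auto
  also have "card (?lift ` ?E A (b - w i)) = card (?E A (b - w i))"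
  proof (rule card_image, rule inj_onI, clarsimp)
    fix S T assume "S \<subseteq> A" "T \<subseteq> A" "insert i S = insert i T"
    then show "S = T" using inj by (auto simp: inj_on_def)
  qed
  also have "card ((\<lambda>S. (S, i)) ` ?C) = card ?C"
    by (rule card_image) (auto simp: inj_on_def)
  finally show ?thesis using cV by (simp add: section_count_def)
qed

text \<open>
  The cube is a prism in a direction parallel to the hyperplane: both slices have the same level
  and no edge in this direction is crossed.
\<close>

lemma section_count_zero_weights:
  assumes "finite Z" "finite A" "Z \<inter> A = {}" "\<And>i. i \<in> Z \<Longrightarrow> w i = 0"
  shows "section_count (Z \<union> A) w b = 2 ^ card Z * section_count A w b"
  using assms
proof (induction Z rule: finite_induct)
  case (insert i Z)
  have "\<not> (x::real) * x < 0" for x by (simp add: not_less)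
  then have "section_count (insert i (Z \<union> A)) w b = 2 * section_count (Z \<union> A) w b"
    using insert.prems insert.hyps by (subst section_count_insert) auto
  then show ?case using insert by auto
qed simp

lemma section_count_cong:
  assumes "\<And>i. i \<in> A \<Longrightarrow> w i = v i"
  shows "section_count A w b = section_count A v b"
proof -
  have s: "sum w S = sum v S" if "S \<subseteq> A" for S
    using that assms by (intro sum.cong) auto
  have "sum w (insert i S) = sum v (insert i S)" if "S \<subseteq> A" "i \<in> A" for S i
    using that by (intro s) auto
  with s show ?thesis unfolding section_count_def
    by (intro arg_cong2[where f = "(+)"] arg_cong[where f = card]) auto
qed

text \<open>
  The reflection \<open>x i \<mapsto> 1 - x i\<close> of the cube exchanges the two slices in the recursion.
\<close>

lemma section_count_flip_single:
  assumes "finite A" "i \<in> A"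
  shows "section_count A w b = section_count A (w(i := - w i)) (b - w i)"
proof -
  define B where "B = A - {i}"
  have A: "A = insert i B" "finite B" "i \<notin> B" using assms by (auto simp: B_def)
  let ?v = "w(i := - w i)"
  have c: "section_count B ?v c = section_count B w c" for c
    using A by (intro section_count_cong) auto
  have "sum ?v S = sum w S" if "S \<subseteq> B" for S
    using that A by (intro sum.cong) auto
  then have "{S. S \<subseteq> B \<and> (sum ?v S - (b - w i)) * (sum ?v S + ?v i - (b - w i)) < 0}
    = {S. S \<subseteq> B \<and> (sum w S - b) * (sum w S + w i - b) < 0}"
    by (auto simp: algebra_simps)
  then show ?thesis unfolding A(1) 
    by (simp only: section_count_insert[OF A(2,3)] c) simp
qed

lemma section_count_flip:
  assumes "finite A" "B \<subseteq> A"
  shows "section_count A w b = section_count A (\<lambda>i. if i \<in> B then - w i else w i) (b - sum w B)"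
proof -
  have "finite B" using assms finite_subset by auto
  then show ?thesis using assms(2)
  proof (induction B rule: finite_induct)
    case (insert i B)
    let ?v = "\<lambda>i. if i \<in> B then - w i else w i"
    have "section_count A w b = section_count A (?v(i := - ?v i)) (b - sum w B - ?v i)"
      using insert.IH insert.prems section_count_flip_single[OF assms(1), of i ?v] by auto
    also have "?v(i := - ?v i) = (\<lambda>j. if j \<in> insert i B then - w j else w j)"
      using insert.hyps by auto
    also have "b - sum w B - ?v i = b - sum w (insert i B)"
      using insert.hyps by simp
    finally show ?case .
  qed simp
qed

lemma section_count_uminus: "section_count A (\<lambda>i. - w i) (- b) = section_count A w b"
proof -
  have "(- x + b) * (- y + b) = (x - b) * (y - (b::real))" for x y by (simp add: algebra_simps)
  then show ?thesis by (simp add: section_count_def sum_negf)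
qed

text \<open>
  The point reflection of the cube at its centre: flip all coordinates, then multiply the equation
  of the hyperplane by \<open>- 1\<close>. This is the symmetry that halves the case distinctions below.
\<close>

lemma section_count_complement:
  assumes "finite A"
  shows "section_count A w (sum w A - b) = section_count A w b"
proof -
  have "section_count A w b = section_count A (\<lambda>i. if i \<in> A then - w i else w i) (- (sum w A - b))"
    using section_count_flip[OF assms, of A w b] by simp
  also have "\<dots> = section_count A (\<lambda>i. - w i) (- (sum w A - b))"
    by (rule section_count_cong) simp
  also have "\<dots> = section_count A w (sum w A - b)" by (rule section_count_uminus)
  finally show ?thesis ..
qed

lemma section_count_negative:
  assumes "\<And>i. i \<in> A \<Longrightarrow> 0 \<le> w i" "b < 0"
  shows "section_count A w b = 0"
proof -
  have s: "b < sum w S" if "S \<subseteq> A" for S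
    using that assms sum_nonneg[of S w] by (meson less_le_trans subsetD)
  then have "b < sum w (insert i S)" if "S \<subseteq> A" "i \<in> A" for S i using that by auto
  then have "0 < (sum w S - b) * (sum w (insert i S) - b)" if "S \<subseteq> A" "i \<in> A" for S i
    using that s[of S] by (intro mult_pos_pos) auto
  then have E: "{(S, i). S \<subseteq> A \<and> i \<in> A - S \<and> (sum w S - b) * (sum w (insert i S) - b) < 0} = {}"
    by (auto dest: less_asym)
  have V: "{S. S \<subseteq> A \<and> sum w S = b} = {}" using s by auto
  show ?thesis unfolding section_count_def E V by simp
qed

lemma section_count_vertex:
  assumes A: "finite A" and w: "\<And>i. i \<in> A \<Longrightarrow> 0 < w i"
  shows "section_count A w 0 = 1"
proof -
  have s: "0 \<le> sum w S" if "S \<subseteq> A" for S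
    using that w by (intro sum_nonneg) (auto intro: less_imp_le)
  then have "0 \<le> sum w (insert i S)" if "S \<subseteq> A" "i \<in> A" for S i using that by auto
  then have "0 \<le> (sum w S - 0) * (sum w (insert i S) - 0)" if "S \<subseteq> A" "i \<in> A" for S i
    using that s[of S] by (intro mult_nonneg_nonneg) auto
  then have E: "{(S, i). S \<subseteq> A \<and> i \<in> A - S \<and> (sum w S - 0) * (sum w (insert i S) - 0) < 0} = {}"
    by (auto simp: not_less[symmetric])
  have "S = {}" if "S \<subseteq> A" "sum w S = 0" for S
  proof (rule ccontr)
    assume "S \<noteq> {}"
    then have "0 < sum w S" using that w A finite_subset by (intro sum_pos) auto
    with that show False by simp
  qed
  then have "{S. S \<subseteq> A \<and> sum w S = 0} = {{}}" by auto
  then show ?thesis unfolding section_count_def E by simp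
qed

lemma section_count_insert_pos:
  assumes A: "finite A" "i \<notin> A" and w: "0 < w i"
  shows "section_count (insert i A) w b = section_count A w b + section_count A w (b - w i)
     + card {S. S \<subseteq> A \<and> b - w i < sum w S \<and> sum w S < b}"
proof -
  have "(x - b) * (x + w i - b) < 0 \<longleftrightarrow> b - w i < x \<and> x < b" for x
    using w by (auto simp: mult_less_0_iff)
  then show ?thesis by (simp add: section_count_insert[OF A])
qed

lemma nonempty_sum_ge:
  assumes "finite A" "\<And>i. i \<in> A \<Longrightarrow> (0::real) < w i" "S \<subseteq> A" "i \<in> S"
  shows "w i \<le> sum w S"
  using assms by (intro member_le_sum) (auto intro: less_imp_le finite_subset)

text \<open>
  Only the empty set has weight below \<open>b\<close>, so the hyperplane separates one cube vertex from the
  others, and each edge at this vertex contributes one vertex of the section. The bounds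
  \<open>b \<le> w i\<close> are not strict because a neighbour lying on the hyperplane contributes one vertex too.
\<close>

lemma section_count_corner:
  assumes "finite A" "0 < b" "\<And>i. i \<in> A \<Longrightarrow> b \<le> w i"
  shows "section_count A w b = card A"
  using assms
proof (induction A rule: finite_induct)
  case (insert i A)
  have pos: "0 < w j" if "j \<in> insert i A" for j using insert.prems that by fastforce
  have "S = {}" if "S \<subseteq> A" "sum w S < b" for S
  proof (rule ccontr)
    assume "S \<noteq> {}"
    then obtain j where "j \<in> S" by auto
    then have "w j \<le> sum w S" using that pos insert.hyps
      by (intro nonempty_sum_ge[of A]) auto
    moreover have "b \<le> w j" using \<open>j \<in> S\<close> that insert.prems by auto
    ultimately show False using that by simp
  qed
  then have "S \<subseteq> A \<and> b - w i < sum w S \<and> sum w S < b \<longleftrightarrow> S = {} \<and> b < w i" for S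
    using insert.prems(1) by (cases "S = {}") auto
  then have t: "{S. S \<subseteq> A \<and> b - w i < sum w S \<and> sum w S < b} = (if b < w i then {{}} else {})"
    by auto
  have c: "section_count A w (b - w i) = (if b < w i then 0 else 1)"
  proof (cases "b < w i")
    case True then show ?thesis using pos by (auto intro!: section_count_negative less_imp_le)
  next
    case False
    then have "b - w i = 0" using insert.prems(2)[of i] by auto
    then show ?thesis using section_count_vertex[of A w] insert.hyps pos False by auto
  qed
  show ?case using insert pos by (simp add: section_count_insert_pos t c)
qed (simp add: section_count_empty)

text \<open>
  Here the empty set and \<open>{i}\<close> are the two sets of weight below \<open>b\<close>. Both slices in direction
  \<open>i\<close> are corners and the edge in direction \<open>i\<close> at the empty set is not crossed.
\<close>

lemma section_count_edge:
  assumes A: "finite A" and i: "i \<in> A" "0 < w i" "w i < b" and far: "\<And>j. j \<in> A - {i} \<Longrightarrow> b \<le> w j"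
  shows "section_count A w b = 2 * card A - 2"
proof -
  define B where "B = A - {i}"
  have B: "A = insert i B" "finite B" "i \<notin> B" using A i by (auto simp: B_def)
  have far': "b \<le> w j" if "j \<in> B" for j using far that by (auto simp: B_def)
  have "\<not> (S \<subseteq> B \<and> b - w i < sum w S \<and> sum w S < b)" for S
  proof
    assume S: "S \<subseteq> B \<and> b - w i < sum w S \<and> sum w S < b"
    then have "S \<noteq> {}" using i by auto
    then obtain j where "j \<in> S" by auto
    then have "w j \<le> sum w S" using S far' B i
      by (intro nonempty_sum_ge[of B]) fastforce+
    then show False using far' \<open>j \<in> S\<close> S by fastforce
  qed
  then have "{S. S \<subseteq> B \<and> b - w i < sum w S \<and> sum w S < b} = {}" by auto
  moreover have "section_count B w b = card B"
    using B i far' by (intro section_count_corner) auto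
  moreover have "section_count B w (b - w i) = card B"
    using B i far' by (intro section_count_corner) fastforce+
  ultimately show ?thesis using B i by (simp add: section_count_insert_pos)
qed

section \<open>Sections by hyperplanes with positive weights\<close>

text \<open>
  For a least weight \<open>w i\<close>, the failure of both corner conditions amounts to \<open>w i < b\<close> and
  \<open>b < sum w A - w i\<close>, and this says that both slices orthogonal to \<open>i\<close>, with levels \<open>b\<close> and
  \<open>b - w i\<close>, are again cut strictly between their extreme vertices.
\<close>

lemma section_count_cases:
  fixes w :: "'a \<Rightarrow> real"
  assumes A: "finite A" and w: "\<forall>i\<in>A. 0 < w i" and b: "0 < b" "b < sum w A"
  obtains (corner) "\<forall>j\<in>A. b \<le> w j"
  | (opposite_corner) "\<forall>j\<in>A. sum w A - b \<le> w j"
  | (central) i where "i \<in> A" "\<forall>j\<in>A. w i \<le> w j" "w i < b" "b < sum w (A - {i})"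
proof -
  have "A \<noteq> {}"
  proof
    assume "A = {}"
    then show False using b by simp
  qed
  define i where "i = arg_min_on w A"
  have i: "i \<in> A" "\<forall>j\<in>A. w i \<le> w j"
    using arg_min_if_finite(1)[OF A \<open>A \<noteq> {}\<close>] arg_min_least[OF A \<open>A \<noteq> {}\<close>] by (auto simp: i_def)
  have s: "sum w A = w i + sum w (A - {i})" using i A by (simp add: sum.remove)
  show thesis
  proof (cases "b \<le> w i \<or> sum w A - b \<le> w i")
    case True
    then show thesis using corner opposite_corner i(2) by (metis order_trans)
  next
    case False
    then show thesis using central[OF i] s by auto
  qed
qed

lemma section_count_opposite_corner:
  assumes "finite A" "b < sum w A" "\<forall>j\<in>A. sum w A - b \<le> w j"
  shows "section_count A w b = card A"
  using section_count_corner[of A "sum w A - b" w] section_count_complement[of A w b] assms by auto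

lemma section_count_remove:
  assumes "finite A" "i \<in> A" "0 < w i"
  shows "section_count A w b = section_count (A - {i}) w b + section_count (A - {i}) w (b - w i)
     + card {S. S \<subseteq> A - {i} \<and> b - w i < sum w S \<and> sum w S < b}"
  using section_count_insert_pos[of "A - {i}" i w b] assms by (simp add: insert_absorb)

lemma section_count_ge_card:
  assumes "finite A" "\<forall>i\<in>A. 0 < w i" "0 < b" "b < sum w A"
  shows "card A \<le> section_count A w b"
  using assms
proof (induction "card A" arbitrary: A b rule: less_induct)
  case less
  show ?case
    using less.prems
  proof (cases rule: section_count_cases)
    case corner
    then show ?thesis using less.prems by (simp add: section_count_corner)
  next
    case opposite_corner
    then show ?thesis using less.prems by (simp add: section_count_opposite_corner)
  next
    case (central i)
    let ?B = "A - {i}"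
    have "?B \<noteq> {}"
    proof
      assume "?B = {}"
      then show False using central less.prems by (simp only: sum.empty)
    qed
    then have "0 < card ?B" using \<open>finite A\<close> by (simp only: card_gt_0_iff finite_Diff simp_thms)
    moreover have "card A = Suc (card ?B)" using \<open>finite A\<close> central(1) by (rule card.remove)
    ultimately have c: "card ?B = card A - 1" "2 \<le> card A" by linarith+
    have s: "sum w A = w i + sum w ?B" using central less.prems by (simp add: sum.remove)
    have "card ?B \<le> section_count ?B w b"
      using less.prems central c by (intro less.hyps) auto
    moreover have "card ?B \<le> section_count ?B w (b - w i)"
      using less.prems central c s by (intro less.hyps) auto
    moreover have "section_count A w b = section_count ?B w b + section_count ?B w (b - w i)
        + card {S. S \<subseteq> ?B \<and> b - w i < sum w S \<and> sum w S < b}"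
      using less.prems central by (intro section_count_remove) auto
    ultimately show ?thesis using c by linarith
  qed
qed

text \<open>
  In the third case of the distinction by least weight each slice contributes at least
  \<open>card A - 1\<close>.
\<close>

lemma section_count_ge_twice:
  assumes A: "finite A" and w: "\<forall>i\<in>A. 0 < w i" and b: "0 < b" "b < sum w A"
  obtains (corner) "section_count A w b = card A" "\<forall>j\<in>A. b \<le> w j"
  | (opposite_corner) "section_count A w b = card A" "\<forall>j\<in>A. sum w A - b \<le> w j"
  | (large) "2 * card A - 2 \<le> section_count A w b"
  using A w b
proof (cases rule: section_count_cases)
  case c: corner
  show thesis using corner c section_count_corner[of A b w] A b by auto
next
  case c: opposite_corner
  show thesis using opposite_corner c section_count_opposite_corner[of A b w] A b by auto
next
  case (central i)
  have s: "sum w A = w i + sum w (A - {i})" using central A by (simp add: sum.remove)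
  have "card (A - {i}) \<le> section_count (A - {i}) w b"
    using A w b central by (intro section_count_ge_card) auto
  moreover have "card (A - {i}) \<le> section_count (A - {i}) w (b - w i)"
    using A w b central s by (intro section_count_ge_card) auto
  ultimately show thesis
    using large section_count_remove[of A i w b] A w central by auto
qed

text \<open>
  The two slices cannot cut off corners at opposite ends: almost all weights would be at least
  \<open>b - w i\<close> and at least \<open>sum w (A - {i}) - b\<close>, and adding one weight of each kind and a third
  one, which is at least \<open>w i\<close>, would give \<open>sum w (A - {i})\<close> or more, although three weights
  out of at least four positive ones are less than their sum. The sets \<open>X\<close> and \<open>Y\<close> allow for one exceptional coordinate, which occurs when
  one slice cuts off an edge instead of a corner.
\<close>

lemma slices_not_opposite_corners:
  fixes w :: "'a \<Rightarrow> real"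
  assumes A: "finite A" "4 \<le> card (A - {i})" and w: "\<forall>j\<in>A. 0 < w j"
    and i: "i \<in> A" "\<forall>j\<in>A. w i \<le> w j"
    and x: "\<forall>j\<in>A - {i} - X. b - w i \<le> w j"
    and y: "\<forall>j\<in>A - {i} - Y. sum w (A - {i}) - b \<le> w j"
    and XY: "finite X" "finite Y" "card X + card Y \<le> 1"
  shows False
proof -
  let ?B = "A - {i}"
  have fin: "finite ?B" using A by simp
  have "card (?B - (X \<union> Y)) \<ge> 3"
    using diff_card_le_card_Diff[of "X \<union> Y" ?B] card_Un_le[of X Y] XY A by simp
  then obtain T where T: "T \<subseteq> ?B - (X \<union> Y)" "card T = 3" "finite T"
    by (meson obtain_subset_with_card_n)
  then obtain j k l where jkl: "T = {j, k, l}" "j \<noteq> k" "j \<noteq> l" "k \<noteq> l"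
    by (auto simp: card_3_iff)
  have "T \<noteq> ?B" using T A by auto
  then obtain m where m: "m \<in> ?B - T" using T by auto
  have "sum w T < sum w ?B"
    using fin w m T by (intro sum_strict_mono2[of _ _ m]) (auto intro: less_imp_le)
  moreover have "sum w T = w j + w k + w l" using jkl by simp
  moreover have "b - w i \<le> w j" "sum w ?B - b \<le> w k" "w i \<le> w l"
    using x y i T jkl by auto
  ultimately show False by linarith
qed

text \<open>
  If both slices have the least possible count, both are corners; they are corners at the same end
  by \<open>slices_not_opposite_corners\<close>, and then the hyperplane cuts off the edge in direction \<open>i\<close> at
  this end of the whole cube. Otherwise one slice contributes at least \<open>2 (card A - 1) - 2\<close>. Besides the value, the shape of the
  sections with \<open>2 card A - 2\<close> vertices is recorded, since the next step depends on it.
\<close>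

lemma section_count_ge_thrice:
  assumes A: "finite A" "5 \<le> card A" and w: "\<forall>i\<in>A. 0 < w i" and b: "0 < b" "b < sum w A"
  obtains (corner) "section_count A w b = card A" "\<forall>j\<in>A. b \<le> w j"
  | (opposite_corner) "section_count A w b = card A" "\<forall>j\<in>A. sum w A - b \<le> w j"
  | (edge) i where "section_count A w b = 2 * card A - 2" "i \<in> A" "\<forall>j\<in>A - {i}. b \<le> w j"
  | (opposite_edge) i where "section_count A w b = 2 * card A - 2" "i \<in> A"
      "\<forall>j\<in>A - {i}. sum w A - b \<le> w j"
  | (large) "3 * card A - 5 \<le> section_count A w b"
  using A(1) w b
proof (cases rule: section_count_cases)
  case c: corner
  show thesis using corner c section_count_corner[of A b w] A b by auto
next
  case c: opposite_corner
  show thesis using opposite_corner c section_count_opposite_corner[of A b w] A b by auto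
next
  case (central i)
  let ?B = "A - {i}"
  have wi: "0 < w i" using w central by auto
  have s: "sum w A = w i + sum w ?B" using central A by (simp add: sum.remove)
  have B: "finite ?B" "card ?B = card A - 1" "\<forall>j\<in>?B. 0 < w j" "0 < b - w i" "b - w i < sum w ?B"
    using A w central s b by auto
  have count: "section_count ?B w b + section_count ?B w (b - w i) \<le> section_count A w b"
    using section_count_remove[of A i w b] A wi central by simp
  have ge: "card ?B \<le> section_count ?B w b" "card ?B \<le> section_count ?B w (b - w i)"
    using section_count_ge_card[OF B(1,3) b(1) central(4)] section_count_ge_card[OF B(1,3,4,5)] by auto
  have edge_case: thesis if "\<forall>j\<in>?B. b \<le> w j"
  proof (rule edge[of i])
    show "section_count A w b = 2 * card A - 2"
      using that by (intro section_count_edge[where w = w, OF A(1) central(1) wi central(3)]) blast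
    show "i \<in> A" by (fact central(1))
    show "\<forall>j\<in>?B. b \<le> w j" by (fact that)
  qed
  have opposite_edge_case: thesis if "\<forall>j\<in>?B. sum w A - b \<le> w j"
  proof (rule opposite_edge[of i])
    have "section_count A w (sum w A - b) = 2 * card A - 2"
      using that s central(4) by (intro section_count_edge[where w = w, OF A(1) central(1) wi]) (linarith, blast)
    then show "section_count A w b = 2 * card A - 2"
      using A by (simp add: section_count_complement)
    show "i \<in> A" by (fact central(1))
    show "\<forall>j\<in>?B. sum w A - b \<le> w j" by (fact that)
  qed
  have large_case: thesis
    if "2 * card ?B - 2 \<le> section_count ?B w b \<or> 2 * card ?B - 2 \<le> section_count ?B w (b - w i)"
  proof (rule large)
    show "3 * card A - 5 \<le> section_count A w b" using that count ge B(2) A(2) by linarith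
  qed
  have not_both: False if "\<forall>j\<in>?B. b - w i \<le> w j" "\<forall>j\<in>?B. sum w ?B - b \<le> w j"
  proof (rule slices_not_opposite_corners[OF A(1) _ w central(1,2), where X = "{}" and Y = "{}"])
    show "4 \<le> card ?B" using A(2) B(2) by linarith
  qed (use that in auto)
  from B(1,3) b(1) central(4) show thesis
  proof (cases rule: section_count_ge_twice)
    case corner
    then show thesis using edge_case by simp
  next
    case large
    then show thesis using large_case by simp
  next
    case o: opposite_corner
    from B(1,3,4,5) show thesis
    proof (cases rule: section_count_ge_twice)
      case corner
      then show thesis using not_both o by blast
    next
      case opposite_corner
      moreover have "sum w ?B - (b - w i) = sum w A - b" using s by simp
      ultimately show thesis using opposite_edge_case by simp
    next
      case large
      then show thesis using large_case by simp
    qed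
  qed
qed

text \<open>
  The case in which the slice containing \<open>i\<close> is a corner at the lower end. If the other slice is
  an edge, it has to be an edge at the lower end as well, say in direction \<open>j\<close>; a crossed edge in
  direction \<open>i\<close> starts at a set below the level other than the empty set, that is at \<open>{j}\<close>, so at
  most one is crossed.
\<close>

lemma section_count_lower_corner_slice:
  assumes A: "finite A" "6 \<le> card A" and w: "\<forall>i\<in>A. 0 < w i" and b: "0 < b" "b < sum w A"
    and i: "i \<in> A" "\<forall>j\<in>A. w i \<le> w j" "w i < b" "b < sum w (A - {i})"
    and c: "section_count (A - {i}) w (b - w i) = card (A - {i})"
    and near: "\<forall>j\<in>A - {i}. b - w i \<le> w j"
  shows "section_count A w b \<in> {2 * card A - 2, 3 * card A - 5, 3 * card A - 4}
    \<or> 4 * card A - 9 \<le> section_count A w b"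
proof -
  let ?B = "A - {i}"
  let ?T = "{S. S \<subseteq> ?B \<and> b - w i < sum w S \<and> sum w S < b}"
  have wi: "0 < w i" using w i by auto
  have s: "sum w A = w i + sum w ?B" using i A by (simp add: sum.remove)
  have B: "finite ?B" "card ?B = card A - 1" "5 \<le> card ?B" "\<forall>j\<in>?B. 0 < w j" "0 < b - w i" "b - w i < sum w ?B"
    using A w i s b by auto
  have count: "section_count A w b = section_count ?B w b + card ?B + card ?T"
    using section_count_remove[of A i w b] A wi i c by simp
  have contra: False if "\<forall>k\<in>?B - Y. sum w ?B - b \<le> w k" "finite Y" "card Y \<le> 1" for Y
  proof (rule slices_not_opposite_corners[OF A(1) _ w i(1,2), where X = "{}" and Y = Y])
    show "4 \<le> card ?B" using B(3) by linarith
  qed (use that near in auto)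
  from B(1,3,4) b(1) i(4) show ?thesis
  proof (cases rule: section_count_ge_thrice)
    case corner
    then have "section_count A w b = 2 * card A - 2"
      by (intro section_count_edge[where w = w, OF A(1) i(1) wi i(3)]) blast
    then show ?thesis by simp
  next
    case opposite_corner
    then show ?thesis using contra[of "{}"] by auto
  next
    case (edge j)
    have "S = {j}" if "S \<in> ?T" for S
    proof -
      have "S \<noteq> {}" using that B(5) by auto
      moreover have "k = j" if "k \<in> S" for k
      proof (rule ccontr)
        assume "k \<noteq> j"
        then have "b \<le> w k" using edge that \<open>S \<in> ?T\<close> by auto
        moreover have "w k \<le> sum w S"
          using \<open>S \<in> ?T\<close> that B by (intro nonempty_sum_ge[of ?B]) auto
        ultimately show False using \<open>S \<in> ?T\<close> by auto
      qed
      ultimately show ?thesis by auto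
    qed
    then have "?T \<subseteq> {{j}}" by auto
    then have "card ?T \<le> 1" using card_mono[of "{{j}}" ?T] by simp
    then have "section_count A w b = 3 * card A - 5 \<or> section_count A w b = 3 * card A - 4"
      using count edge(1) B(2,3) by linarith
    then show ?thesis by blast
  next
    case (opposite_edge j)
    have False
    proof (rule contra)
      show "\<forall>k\<in>?B - {j}. sum w ?B - b \<le> w k" by (fact opposite_edge(3))
    qed simp_all
    then show ?thesis ..
  next
    case large
    then have "4 * card A - 9 \<le> section_count A w b" using count B(2,3) by linarith
    then show ?thesis ..
  qed
qed

text \<open>
  For \<open>card A = 4\<close> and \<open>card A = 5\<close> the bound \<open>4 card A - 9\<close> equals \<open>3 card A - 5\<close> and
  \<open>3 card A - 4\<close>, respectively, so the coarser bounds suffice. From \<open>card A = 6\<close> on, the slices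
  have dimension at least \<open>5\<close> and their structure is known.
\<close>

lemma section_count_positive:
  assumes A: "finite A" "4 \<le> card A" and w: "\<forall>i\<in>A. 0 < w i" and b: "0 < b" "b < sum w A"
  shows "section_count A w b \<in> {card A, 2 * card A - 2, 3 * card A - 5, 3 * card A - 4}
    \<or> 4 * card A - 9 \<le> section_count A w b"
proof -
  consider "card A = 4" | "card A = 5" | "6 \<le> card A" using A(2) by linarith
  then show ?thesis
  proof cases
    case 1
    then show ?thesis
      by (rule_tac section_count_ge_twice[OF A(1) w b]) auto
  next
    case 2
    then have "5 \<le> card A" by simp
    then show ?thesis using 2
      by (rule_tac section_count_ge_thrice[OF A(1) _ w b]) auto
  next
    case 3
    from A(1) w b show ?thesis
    proof (cases rule: section_count_cases)
      case corner
      then show ?thesis using section_count_corner[of A b w] A b by auto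
    next
      case opposite_corner
      then show ?thesis using section_count_opposite_corner[of A b w] A b by auto
    next
      case (central i)
      let ?B = "A - {i}"
      have wi: "0 < w i" using w central by auto
      have s: "sum w A = w i + sum w ?B" using central A by (simp add: sum.remove)
      have B: "finite ?B" "card ?B = card A - 1" "5 \<le> card ?B" "\<forall>j\<in>?B. 0 < w j"
        "0 < b - w i" "b - w i < sum w ?B"
        using A w central s b 3 by auto
      have count: "section_count ?B w b + section_count ?B w (b - w i) \<le> section_count A w b"
        using section_count_remove[of A i w b] A wi central by simp
      have below: ?thesis if "section_count ?B w (b - w i) = card ?B" "\<forall>j\<in>?B. b - w i \<le> w j"
        using section_count_lower_corner_slice[OF A(1) 3 w b central that] by auto
      \<comment> \<open>Reflection in the centre exchanges the roles of the two slices.\<close>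
      have above: ?thesis if "section_count ?B w b = card ?B" "\<forall>j\<in>?B. sum w ?B - b \<le> w j"
      proof -
        have "section_count ?B w (sum w A - b - w i) = card ?B"
          using section_count_complement[OF B(1), of w b] that s by (simp add: algebra_simps)
        then have "section_count A w (sum w A - b) \<in> {2 * card A - 2, 3 * card A - 5, 3 * card A - 4}
            \<or> 4 * card A - 9 \<le> section_count A w (sum w A - b)"
          using that s B b central by (intro section_count_lower_corner_slice[OF A(1) 3 w _ _ central(1,2)]) (auto simp: algebra_simps)
        then show ?thesis using section_count_complement[OF A(1), of w b] by auto
      qed
      have two: ?thesis if "2 * card ?B - 2 \<le> section_count ?B w b" "2 * card ?B - 2 \<le> section_count ?B w (b - w i)"
      proof -
        have "4 * card A - 9 \<le> section_count A w b" using that count B(2,3) by linarith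
        then show ?thesis ..
      qed
      have at_edge: ?thesis if "\<forall>j\<in>?B. b \<le> w j"
      proof -
        have "section_count A w b = 2 * card A - 2"
          using that by (intro section_count_edge[where w = w, OF A(1) central(1) wi central(3)]) blast
        then show ?thesis by simp
      qed
      have at_opposite_edge: ?thesis if "\<forall>j\<in>?B. sum w A - b \<le> w j"
      proof -
        have "section_count A w (sum w A - b) = 2 * card A - 2"
          using that s central(4)
          by (intro section_count_edge[where w = w, OF A(1) central(1) wi]) (linarith, blast)
        then show ?thesis using section_count_complement[OF A(1), of w b] by simp
      qed
      show ?thesis
      proof (rule section_count_ge_twice[OF B(1,4) b(1) central(4)])
        assume "\<forall>j\<in>?B. b \<le> w j" then show ?thesis by (rule at_edge)
      next
        assume "section_count ?B w b = card ?B" "\<forall>j\<in>?B. sum w ?B - b \<le> w j"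
        then show ?thesis by (rule above)
      next
        assume large: "2 * card ?B - 2 \<le> section_count ?B w b"
        show ?thesis
        proof (rule section_count_ge_twice[OF B(1,4,5,6)])
          assume "section_count ?B w (b - w i) = card ?B" "\<forall>j\<in>?B. b - w i \<le> w j"
          then show ?thesis by (rule below)
        next
          assume "\<forall>j\<in>?B. sum w ?B - (b - w i) \<le> w j"
          moreover have "sum w ?B - (b - w i) = sum w A - b" using s by simp
          ultimately show ?thesis using at_opposite_edge by simp
        next
          assume "2 * card ?B - 2 \<le> section_count ?B w (b - w i)"
          then show ?thesis using two large by simp
        qed
      qed
    qed
  qed
qed

section \<open>All small values of the count\<close>

text \<open>
  Reflect the cube in all coordinates of negative weight.
\<close>

lemma section_count_positive_weights:
  assumes A: "finite A" and w: "\<forall>i\<in>A. w i \<noteq> 0"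
  obtains v c where "\<forall>i\<in>A. (0::real) < v i" "section_count A w b = section_count A v c"
proof
  let ?N = "{i \<in> A. w i < 0}"
  show "section_count A w b
      = section_count A (\<lambda>i. if i \<in> ?N then - w i else w i) (b - sum w ?N)"
    using A by (rule section_count_flip) auto
  show "\<forall>i\<in>A. 0 < (if i \<in> ?N then - w i else w i)"
    using w by force
qed

text \<open>
  The hyperplane misses the cube or touches it in a single vertex.
\<close>

lemma section_count_trivial_level:
  assumes A: "finite A" and w: "\<forall>i\<in>A. 0 < w i" and b: "\<not> (0 < b \<and> b < sum w A)"
  shows "section_count A w b \<in> {0, 1}"
proof -
  have low: "section_count A w c \<in> {0, 1}" if "c \<le> 0" for c
  proof (cases "c = 0")
    case True
    then show ?thesis using section_count_vertex[OF A] w by simp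
  next
    case False
    then have "section_count A w c = 0"
      using that w by (intro section_count_negative) (auto intro: less_imp_le)
    then show ?thesis by simp
  qed
  show ?thesis
  proof (cases "b \<le> 0")
    case True
    then show ?thesis by (rule low)
  next
    case False
    then have "section_count A w (sum w A - b) \<in> {0, 1}" using b by (intro low) auto
    then show ?thesis by (simp only: section_count_complement[OF A])
  qed
qed

lemma power2_mult_ge:
  fixes k n :: nat
  assumes "2 \<le> k" "2 \<le> n"
  shows "4 * (k + n) - 8 \<le> 2 ^ k * n"
  using assms
proof (induction k rule: dec_induct)
  case (step k)
  have "4 * (Suc k + n) - 8 \<le> 4 + (4 * (k + n) - 8)" by simp
  also have "\<dots> \<le> 4 + 2 ^ k * n" using step.IH assms(2) by simp
  also have "(4::nat) \<le> 2 ^ k * n"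
    using mult_le_mono[of "2 ^ 1" "2 ^ k" 2 n] power_increasing[of 1 k "2::nat"] step.hyps assms(2) by simp
  finally show ?case by simp
qed simp

text \<open>
  With \<open>k\<close> zero weights the count is \<open>2 ^ k\<close> times that of \<open>n = d - k\<close> nonzero weights. For
  \<open>k = 1\<close> the bound \<open>2 (2 n - 2) = 4 d - 8\<close> is already large, so only corners matter, and for
  \<open>k \<ge> 2\<close> even corners are large unless \<open>n = 1\<close>.
\<close>

lemma section_count_values:
  fixes w :: "'a \<Rightarrow> real" and b :: real
  assumes A: "finite A" "4 \<le> card A" and w: "i \<in> A" "w i \<noteq> 0"
  defines "d \<equiv> card A" and "g \<equiv> section_count A w b"
  shows "g = 0 \<or> (\<exists>k\<le>d - 1. g = 2 ^ k) \<or> g \<in> {d, 2 * d - 2, 3 * d - 5, 3 * d - 4} \<or> 4 * d - 9 \<le> g"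
proof -
  define Z where "Z = {j \<in> A. w j = 0}"
  define N where "N = {j \<in> A. w j \<noteq> 0}"
  define k where "k = card Z"
  define n where "n = card N"
  have ZN: "A = Z \<union> N" "finite Z" "finite N" "Z \<inter> N = {}" using A by (auto simp: Z_def N_def)
  have d: "d = k + n" unfolding d_def k_def n_def using ZN card_Un_disjoint[of Z N] by simp
  have "N \<noteq> {}" using w by (auto simp: N_def)
  then have n: "1 \<le> n" using ZN(3) by (simp add: n_def Suc_le_eq card_gt_0_iff)
  obtain v c where v: "\<forall>j\<in>N. 0 < v j" and vc: "section_count N w b = section_count N v c"
  proof (rule section_count_positive_weights[OF ZN(3)])
    show "\<forall>j\<in>N. w j \<noteq> 0" by (simp add: N_def)
  qed
  define h where "h = section_count N v c"
  have "g = 2 ^ k * section_count N w b"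
    unfolding g_def k_def ZN(1) using ZN(2-4)
    by (intro section_count_zero_weights) (auto simp: Z_def)
  then have g: "g = 2 ^ k * h" by (simp add: vc h_def)
  have kd: "k \<le> d - 1" using d n by simp
  show ?thesis
  proof (cases "h \<in> {0, 1}")
    case True
    then show ?thesis using g kd by auto
  next
    case False
    then have c: "0 < c" "c < sum v N"
      using section_count_trivial_level[OF ZN(3) v, of c] by (auto simp: h_def)
    have hn: "n \<le> h" unfolding h_def n_def by (rule section_count_ge_card[OF ZN(3) v c])
    have n2: "2 \<le> n"
    proof (rule ccontr)
      assume "\<not> 2 \<le> n"
      then have "n = 1" using n by simp
      then obtain j where "N = {j}" unfolding n_def by (auto simp: card_1_singleton_iff)
      then have "h = 1" unfolding h_def using c section_count_corner[of N c v] by simp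
      then show False using False by simp
    qed
    consider "k = 0" | "k = 1" | "2 \<le> k" by linarith
    then show ?thesis
    proof cases
      case 1
      then have "h \<in> {n, 2 * n - 2, 3 * n - 5, 3 * n - 4} \<or> 4 * n - 9 \<le> h"
        using section_count_positive[OF ZN(3) _ v c] A(2) d by (simp add: h_def n_def d_def)
      moreover have "g = h" "d = n" using g d 1 by simp_all
      ultimately show ?thesis by blast
    next
      case 2
      have "h = n \<or> 2 * n - 2 \<le> h"
        unfolding h_def n_def by (rule section_count_ge_twice[OF ZN(3) v c]) auto
      then have "g = 2 * d - 2 \<or> 4 * d - 9 \<le> g" using g d 2 by auto
      then show ?thesis by blast
    next
      case 3
      have "4 * d - 8 \<le> 2 ^ k * n" unfolding d by (rule power2_mult_ge[OF 3 n2])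
      also have "\<dots> \<le> g" using hn by (simp add: g)
      finally show ?thesis by linarith
    qed
  qed
qed

text \<open>
  The restriction to weights that are not all zero expresses that \<open>w\<close> is the normal vector of a
  hyperplane.
\<close>

definition section_counts :: "'a set \<Rightarrow> nat set" where
  "section_counts A = {section_count A w b | w b. \<exists>i\<in>A. w i \<noteq> 0}"

lemma section_countsI: "i \<in> A \<Longrightarrow> w i \<noteq> 0 \<Longrightarrow> section_count A w b = m \<Longrightarrow> m \<in> section_counts A"
  by (auto simp: section_counts_def)

text \<open>
  Prisms over a single vertex and over a corner section.
\<close>

lemma section_counts_cylinder:
  assumes "finite A" "N \<subseteq> A" "N \<noteq> {}"
  defines "w \<equiv> (\<lambda>i. if i \<in> N then 1 else 0 :: real)"
  shows "section_count A w 0 = 2 ^ (card A - card N)"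
    and "section_count A w 1 = 2 ^ (card A - card N) * card N"
proof -
  have N: "finite N" using assms finite_subset by auto
  have "section_count ((A - N) \<union> N) w b = 2 ^ card (A - N) * section_count N w b" for b
    using assms N by (intro section_count_zero_weights) auto
  moreover have "(A - N) \<union> N = A" using assms by auto
  ultimately have c: "section_count A w b = 2 ^ (card A - card N) * section_count N w b" for b
    using N assms by (simp add: card_Diff_subset)
  have "section_count N w 0 = 1" "section_count N w 1 = card N"
    by (rule section_count_vertex[OF N], simp add: w_def)
      (rule section_count_corner[OF N], simp_all add: w_def)
  then show "section_count A w 0 = 2 ^ (card A - card N)"
    "section_count A w 1 = 2 ^ (card A - card N) * card N" by (simp_all add: c)
qed

text \<open>
  At level \<open>3 / 2\<close> the three sets \<open>{}\<close>, \<open>{i}\<close>, \<open>{j}\<close> are cut off, and all others lie strictly above.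
  At level \<open>2\<close> the set \<open>{i, j}\<close> lies on the hyperplane, so that the two crossed edges ending in
  it are replaced by a single vertex; the other sets on the hyperplane are the \<open>{k}\<close> with
  \<open>k \<in> R\<close>, each of which replaces just one crossed edge.
\<close>

lemma section_counts_two_adjacent_edges:
  assumes R: "finite R" "i \<notin> R" "j \<notin> R" "i \<noteq> j"
  defines "A \<equiv> insert i (insert j R)" and "w \<equiv> (\<lambda>k. if k \<in> R then 2 else 1 :: real)"
  shows "section_count A w 2 = 3 * card A - 5" and "section_count A w (3 / 2) = 3 * card A - 4"
proof -
  let ?B = "insert j R"
  have B: "finite ?B" "i \<notin> ?B" "w i = 1" "w j = 1" "card ?B = card R + 1" "card A = card R + 2"
    using R by (auto simp: A_def w_def)
  have count: "section_count A w b = section_count ?B w b + section_count ?B w (b - 1)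
      + card {S. S \<subseteq> ?B \<and> b - 1 < sum w S \<and> sum w S < b}" for b
    unfolding A_def using section_count_insert_pos[OF B(1,2), of w b] B(3) by simp
  have edge: "section_count ?B w b = 2 * card ?B - 2" if "1 < b" "b \<le> 2" for b
    using that R B by (intro section_count_edge[of _ j]) (auto simp: w_def)
  have corner: "section_count ?B w b = card ?B" if "0 < b" "b \<le> 1" for b
    using that B(1) by (intro section_count_corner) (auto simp: w_def)
  have small: "S = {} \<or> S = {j}" if "S \<subseteq> ?B" "sum w S < 2" for S
  proof -
    have "k = j" if "k \<in> S" for k
    proof (rule ccontr)
      assume "k \<noteq> j"
      then have "w k = 2" using that \<open>S \<subseteq> ?B\<close> by (auto simp: w_def)
      moreover have "w k \<le> sum w S"
        using that \<open>S \<subseteq> ?B\<close> B(1) by (intro nonempty_sum_ge[of ?B]) (auto simp: w_def)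
      ultimately show False using \<open>sum w S < 2\<close> by simp
    qed
    then show ?thesis by auto
  qed
  have "\<not> (S \<subseteq> ?B \<and> 2 - 1 < sum w S \<and> sum w S < 2)" for S
    using small[of S] B(4) by auto
  then have t: "{S. S \<subseteq> ?B \<and> 2 - 1 < sum w S \<and> sum w S < 2} = {}" by blast
  show "section_count A w 2 = 3 * card A - 5"
    unfolding count[of 2] t using edge[of 2] corner[of "2 - 1"] B(5,6) by simp
  have "S \<subseteq> ?B \<and> 3 / 2 - 1 < sum w S \<and> sum w S < 3 / 2 \<longleftrightarrow> S = {j}" for S
  proof
    assume "S = {j}" then show "S \<subseteq> ?B \<and> 3 / 2 - 1 < sum w S \<and> sum w S < 3 / 2"
      using B(4) by simp
  next
    assume S: "S \<subseteq> ?B \<and> 3 / 2 - 1 < sum w S \<and> sum w S < 3 / 2"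
    then have "S \<noteq> {}" by auto
    then show "S = {j}" using small[of S] S by linarith
  qed
  then have t': "{S. S \<subseteq> ?B \<and> 3 / 2 - 1 < sum w S \<and> sum w S < 3 / 2} = {{j}}" by blast
  show "section_count A w (3 / 2) = 3 * card A - 4"
    unfolding count[of "3 / 2"] t' using edge[of "3 / 2"] corner[of "3 / 2 - 1"] B(5,6) by simp
qed

lemma section_counts_attained:
  assumes A: "finite A" "4 \<le> card A"
  defines "d \<equiv> card A"
  assumes m: "(\<exists>k\<le>d - 1. m = 2 ^ k) \<or> m \<in> {d, 2 * d - 2, 3 * d - 5, 3 * d - 4, 4 * d - 8}"
  shows "m \<in> section_counts A"
proof -
  have cylinder: "2 ^ k \<in> section_counts A \<and> 2 ^ k * (d - k) \<in> section_counts A" if "k \<le> d - 1" for k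
  proof -
    have "d - k \<le> card A" by (simp add: d_def)
    then obtain N where N: "N \<subseteq> A" "card N = d - k" by (meson obtain_subset_with_card_n)
    let ?v = "\<lambda>i. if i \<in> N then 1 else 0 :: real"
    have "N \<noteq> {}" using N that A by (auto simp: d_def)
    moreover have "card A - card N = k" using N that A by (simp add: d_def)
    ultimately have c: "section_count A ?v 0 = 2 ^ k" "section_count A ?v 1 = 2 ^ k * (d - k)"
      using section_counts_cylinder[OF A(1) N(1)] N(2) by simp_all
    obtain i where "i \<in> N" using \<open>N \<noteq> {}\<close> by blast
    then have i: "i \<in> A" "?v i \<noteq> 0" using N(1) by auto
    show ?thesis
      using section_countsI[of i A ?v, OF i c(1)] section_countsI[of i A ?v, OF i c(2)] ..
  qed
  obtain T where T: "T \<subseteq> A" "card T = 2" using A obtain_subset_with_card_n[of 2 A] by auto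
  then obtain i j where ij: "T = {i, j}" "i \<noteq> j" by (auto simp: card_2_iff)
  let ?w = "\<lambda>k. if k \<in> A - T then 2 else 1 :: real"
  have eq: "insert i (insert j (A - T)) = A" using T ij by auto
  have two: "section_count A ?w 2 = 3 * d - 5" "section_count A ?w (3 / 2) = 3 * d - 4"
    using section_counts_two_adjacent_edges[of "A - T" i j] A(1) ij unfolding eq d_def by auto
  have i: "i \<in> A" "?w i \<noteq> 0" using T ij by auto
  have "3 * d - 5 \<in> section_counts A" "3 * d - 4 \<in> section_counts A"
    using section_countsI[of i A ?w, OF i two(1)] section_countsI[of i A ?w, OF i two(2)] .
  moreover have "d \<in> section_counts A" "2 * d - 2 \<in> section_counts A" "4 * d - 8 \<in> section_counts A"
    using cylinder[of 0] cylinder[of 1] cylinder[of 2] A(2) by (simp_all add: d_def diff_mult_distrib2)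
  ultimately show ?thesis using m cylinder by blast
qed

section \<open>Vertices of sections of the hypercube\<close>

lemma mem_hypercube: "(x :: real ^ 'n::finite) \<in> hypercube \<longleftrightarrow> (\<forall>i. 0 \<le> x $ i \<and> x $ i \<le> 1)"
proof -
  have "{x :: real ^ 'n. \<forall>i. x $ i = 0 \<or> x $ i = 1} = {x. \<forall>k\<in>Basis. x \<bullet> k = 0 \<or> x \<bullet> k = 1}"
    by (auto simp: Basis_vec_def inner_axis)
  then have "hypercube = cbox (0 :: real ^ 'n) One"
    by (simp only: hypercube_def unit_interval_convex_hull)
  then have "x \<in> hypercube \<longleftrightarrow> x \<in> cbox 0 1" by (simp only: Cart_1)
  then show ?thesis by (simp add: mem_box_cart)
qed

text \<open>
  A direction in the hyperplane that is supported on the fractional coordinates of \<open>v\<close> allows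
  \<open>v\<close> to move both ways inside the section.
\<close>

lemma not_extreme_if_movable:
  fixes a v u :: "real ^ 'n::finite"
  assumes v: "\<And>i. 0 \<le> v $ i \<and> v $ i \<le> 1" "a \<bullet> v = b"
    and u: "u \<noteq> 0" "a \<bullet> u = 0" "\<And>i. u $ i \<noteq> 0 \<Longrightarrow> 0 < v $ i \<and> v $ i < 1"
  shows "\<not> v extreme_point_of ({x. a \<bullet> x = b} \<inter> hypercube)"
proof -
  \<comment> \<open>\<open>r i\<close> is how far coordinate \<open>i\<close> may move before \<open>v\<close> leaves the cube; \<open>1\<close> is a dummy for the
    coordinates at rest.\<close>
  define r where "r i = (if u $ i = 0 then 1 else min (v $ i) (1 - v $ i) / \<bar>u $ i\<bar>)" for i
  define e where "e = Min (range r)"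
  have r: "0 < r i" for i using u(3)[of i] by (auto simp: r_def)
  have e: "0 < e" unfolding e_def using r by (subst Min_gr_iff) auto
  have er: "e \<le> r i" for i unfolding e_def by (rule Min_le) auto
  have small: "e * \<bar>u $ i\<bar> \<le> min (v $ i) (1 - v $ i)" for i
  proof (cases "u $ i = 0")
    case True then show ?thesis using v(1)[of i] by simp
  next
    case False
    then show ?thesis using er[of i] by (simp add: r_def pos_le_divide_eq)
  qed
  define x where "x = v - e *\<^sub>R u"
  define y where "y = v + e *\<^sub>R u"
  have "\<bar>e * u $ i\<bar> \<le> min (v $ i) (1 - v $ i)" for i
    using small[of i] e by (simp add: abs_mult)
  then have bnd: "- (v $ i) \<le> e * u $ i \<and> e * u $ i \<le> v $ i \<and> e * u $ i \<le> 1 - v $ i \<and> v $ i - 1 \<le> e * u $ i" for i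
    by (smt (verit))
  have "x \<in> {x. a \<bullet> x = b} \<inter> hypercube" "y \<in> {x. a \<bullet> x = b} \<inter> hypercube"
    unfolding x_def y_def using v u bnd
    by (auto simp: mem_hypercube inner_diff_right inner_add_right) (smt (verit))+
  moreover have "x \<noteq> y"
  proof
    assume "x = y"
    then have "(2 * e) *\<^sub>R u = 0" by (simp add: x_def y_def algebra_simps flip: scaleR_2)
    then show False using e u(1) by simp
  qed
  moreover have "v = midpoint x y"
    by (simp add: midpoint_def x_def y_def flip: scaleR_2)
  ultimately show ?thesis unfolding extreme_point_of_def using midpoint_in_open_segment by blast
qed

text \<open>
  Two fractional coordinates leave a direction of movement within the hyperplane, and so does one
  fractional coordinate of weight zero. Conversely, a segment through \<open>v\<close> keeps the coordinates
  of value \<open>0\<close> or \<open>1\<close> constant, and the equation of the hyperplane fixes the remaining one.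
\<close>

lemma extreme_point_of_section_iff:
  fixes a v :: "real ^ 'n::finite"
  shows "v extreme_point_of ({x. a \<bullet> x = b} \<inter> hypercube) \<longleftrightarrow>
    a \<bullet> v = b \<and> (\<forall>i. 0 \<le> v $ i \<and> v $ i \<le> 1)
    \<and> ((\<forall>j. v $ j = 0 \<or> v $ j = 1)
       \<or> (\<exists>i. 0 < v $ i \<and> v $ i < 1 \<and> a $ i \<noteq> 0 \<and> (\<forall>j. j \<noteq> i \<longrightarrow> v $ j = 0 \<or> v $ j = 1)))"
    (is "?ext \<longleftrightarrow> ?in1 \<and> ?in2 \<and> (?vert \<or> ?edge)")
proof (intro iffI conjI)
  assume ext: ?ext
  then have "v \<in> {x. a \<bullet> x = b} \<inter> hypercube" by (simp add: extreme_point_of_def)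
  then show in1: ?in1 and in2: ?in2 by (auto simp: mem_hypercube)
  have no_move: "u = 0" if "a \<bullet> u = 0" "\<And>i. u $ i \<noteq> 0 \<Longrightarrow> 0 < v $ i \<and> v $ i < 1" for u
    using not_extreme_if_movable[of v a b u] ext in1 in2 that by blast
  show "?vert \<or> ?edge"
  proof (cases ?vert)
    case False
    then obtain i where i: "v $ i \<noteq> 0" "v $ i \<noteq> 1" by auto
    then have fi: "0 < v $ i" "v $ i < 1" using in2 by (auto simp: order_less_le)
    have ai: "a $ i \<noteq> 0"
    proof
      assume "a $ i = 0"
      then have "axis i (1::real) = (0 :: real ^ 'n)"
        using fi by (intro no_move) (auto simp: inner_axis, auto simp: axis_def split: if_splits)
      then show False by (simp add: axis_eq_0_iff)
    qed
    have "v $ j = 0 \<or> v $ j = 1" if "j \<noteq> i" for j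
    proof (rule ccontr)
      assume "\<not> (v $ j = 0 \<or> v $ j = 1)"
      then have fj: "0 < v $ j" "v $ j < 1" using in2 by (auto simp: order_less_le)
      \<comment> \<open>Moving \<open>j\<close> by \<open>a $ i\<close> and \<open>i\<close> by \<open>- a $ j\<close> stays in the hyperplane.\<close>
      have "axis j (a $ i) - axis i (a $ j) = 0"
        using fi fj by (intro no_move) (auto simp: inner_diff_right inner_axis, auto simp: axis_def split: if_splits)
      then have "(axis j (a $ i) - axis i (a $ j)) $ j = 0" by simp
      then show False using that ai by (simp add: axis_def)
    qed
    then show ?thesis using fi ai by blast
  qed simp
next
  assume as: "?in1 \<and> ?in2 \<and> (?vert \<or> ?edge)"
  then obtain i where i: "a $ i \<noteq> 0 \<or> (v $ i = 0 \<or> v $ i = 1)" "\<And>j. j \<noteq> i \<Longrightarrow> v $ j = 0 \<or> v $ j = 1"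
    by blast
  have "v \<notin> open_segment x y"
    if xy: "x \<in> {x. a \<bullet> x = b} \<inter> hypercube" "y \<in> {x. a \<bullet> x = b} \<inter> hypercube" for x y
  proof
    assume "v \<in> open_segment x y"
    then obtain t where t: "0 < t" "t < 1" "v = (1 - t) *\<^sub>R x + t *\<^sub>R y" and ne: "x \<noteq> y"
      by (auto simp: in_segment)
    have cube: "0 \<le> x $ j" "x $ j \<le> 1" "0 \<le> y $ j" "y $ j \<le> 1" for j
      using xy by (auto simp: mem_hypercube)
    have vj: "v $ j = (1 - t) * x $ j + t * y $ j" for j using t by simp
    have fixed: "x $ j = y $ j" if "v $ j = 0 \<or> v $ j = 1" for j
      using that
    proof
      assume "v $ j = 0"
      then have "(1 - t) * x $ j = 0 \<and> t * y $ j = 0"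
        using vj[of j] cube[of j] t by (subst add_nonneg_eq_0_iff[symmetric]) auto
      then show ?thesis using t by simp
    next
      assume "v $ j = 1"
      then have "(1 - t) * (1 - x $ j) + t * (1 - y $ j) = 0"
        using vj[of j] by (simp add: algebra_simps)
      then have "(1 - t) * (1 - x $ j) = 0 \<and> t * (1 - y $ j) = 0"
        using cube[of j] t by (subst (asm) add_nonneg_eq_0_iff) auto
      then show ?thesis using t by simp
    qed
    have "(\<Sum>j\<in>UNIV. a $ j * (x - y) $ j) = 0"
      using xy by (simp add: inner_vec_def algebra_simps sum_subtractf)
    moreover have "(\<Sum>j\<in>UNIV. a $ j * (x - y) $ j) = (\<Sum>j\<in>UNIV. if j = i then a $ i * (x - y) $ i else 0)"
      using fixed i by (intro sum.cong) auto
    ultimately have "a $ i * (x - y) $ i = 0" by simp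
    then have "x $ i = y $ i" using fixed[of i] i(1) by auto
    then have "x $ j = y $ j" for j using fixed[of j] i(2)[of j] by (cases "j = i") auto
    then show False using ne by (simp add: vec_eq_iff)
  qed
  then show ?ext unfolding extreme_point_of_def using as by (auto simp: mem_hypercube)
qed

text \<open>
  The vertex on a crossed edge \<open>(S, i)\<close> is the point at parameter \<open>(b - sum w S) / w i\<close>, and this
  parameter lies strictly between \<open>0\<close> and \<open>1\<close> exactly when the edge is crossed.
\<close>

lemma cv_hypercube:
  fixes a :: "real ^ 'n::finite"
  shows "cv hypercube {x. a \<bullet> x = b} = section_count UNIV (\<lambda>i. a $ i) b"
proof -
  let ?w = "\<lambda>i. a $ i"
  define vert :: "'n set \<Rightarrow> real ^ 'n" where "vert S = (\<chi> i. if i \<in> S then 1 else 0)" for S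
  \<comment> \<open>the point in which the hyperplane crosses the edge from \<open>S\<close> to \<open>insert i S\<close>\<close>
  define pt where "pt = (\<lambda>(S, i). vert S + axis i ((b - sum ?w S) / a $ i))"
  let ?V = "{S. S \<subseteq> UNIV \<and> sum ?w S = b}"
  let ?E = "{(S, i). S \<subseteq> UNIV \<and> i \<in> UNIV - S \<and> (sum ?w S - b) * (sum ?w (insert i S) - b) < 0}"
  have inner_vert: "a \<bullet> vert S = sum ?w S" for S
  proof -
    have "a \<bullet> vert S = (\<Sum>i\<in>UNIV. if i \<in> S then a $ i else 0)"
      unfolding inner_vec_def vert_def by (intro sum.cong) auto
    then show ?thesis by (simp add: sum.If_cases)
  qed
  have vert_eqD: "S = T" if "\<And>j. vert S $ j = vert T $ j" for S T
  proof -
    have ones: "{j. vert R $ j = 1} = R" for R by (auto simp: vert_def split: if_splits)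
    have "{j. vert S $ j = 1} = {j. vert T $ j = 1}" using that by simp
    then show ?thesis by (simp only: ones)
  qed
  have edge_iff: "(sum ?w S - b) * (sum ?w (insert i S) - b) < 0 \<longleftrightarrow>
      a $ i \<noteq> 0 \<and> 0 < (b - sum ?w S) / a $ i \<and> (b - sum ?w S) / a $ i < 1" if "i \<notin> S" for S i
  proof -
    have "sum ?w (insert i S) = a $ i + sum ?w S" using that by simp
    then show ?thesis
      by (cases "a $ i" "0::real" rule: linorder_cases)
        (auto simp: mult_less_0_iff zero_less_divide_iff divide_less_eq)
  qed
  have split: "{v. v extreme_point_of ({x. a \<bullet> x = b} \<inter> hypercube)} = vert ` ?V \<union> pt ` ?E"
  proof (intro set_eqI iffI)
    fix v assume "v \<in> {v. v extreme_point_of ({x. a \<bullet> x = b} \<inter> hypercube)}"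
    then have av: "a \<bullet> v = b" and cases: "(\<forall>j. v $ j = 0 \<or> v $ j = 1)
       \<or> (\<exists>i. 0 < v $ i \<and> v $ i < 1 \<and> a $ i \<noteq> 0 \<and> (\<forall>j. j \<noteq> i \<longrightarrow> v $ j = 0 \<or> v $ j = 1))"
      by (auto simp: extreme_point_of_section_iff)
    define S where "S = {j. v $ j = 1}"
    from cases show "v \<in> vert ` ?V \<union> pt ` ?E"
    proof
      assume "\<forall>j. v $ j = 0 \<or> v $ j = 1"
      then have "v = vert S" by (auto simp: vert_def S_def vec_eq_iff)
      then show ?thesis using av inner_vert[of S] by auto
    next
      assume "\<exists>i. 0 < v $ i \<and> v $ i < 1 \<and> a $ i \<noteq> 0 \<and> (\<forall>j. j \<noteq> i \<longrightarrow> v $ j = 0 \<or> v $ j = 1)"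
      then obtain i where i: "0 < v $ i" "v $ i < 1" "a $ i \<noteq> 0" "\<And>j. j \<noteq> i \<Longrightarrow> v $ j = 0 \<or> v $ j = 1"
        by blast
      have v: "v = vert S + axis i (v $ i)"
        using i by (auto simp: vert_def S_def vec_eq_iff axis_def)
      have "b = sum ?w S + a $ i * v $ i"
        using av by (subst (asm) v) (simp add: inner_add_right inner_vert inner_axis)
      then have t: "v $ i = (b - sum ?w S) / a $ i" using i by (simp add: field_simps)
      have "i \<notin> S" using i by (auto simp: S_def)
      then have "(S, i) \<in> ?E" using i t edge_iff by auto
      moreover have "v = pt (S, i)" using v t by (simp add: pt_def)
      ultimately show ?thesis by blast
    qed
  next
    fix v assume "v \<in> vert ` ?V \<union> pt ` ?E"
    then show "v \<in> {v. v extreme_point_of ({x. a \<bullet> x = b} \<inter> hypercube)}"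
    proof
      assume "v \<in> vert ` ?V"
      then obtain S where "v = vert S" "sum ?w S = b" by auto
      then show ?thesis by (auto simp: extreme_point_of_section_iff inner_vert) (auto simp: vert_def)
    next
      assume "v \<in> pt ` ?E"
      then obtain S i where S: "v = pt (S, i)" "i \<notin> S"
        "(sum ?w S - b) * (sum ?w (insert i S) - b) < 0" by auto
      define t where "t = (b - sum ?w S) / a $ i"
      have t: "a $ i \<noteq> 0" "0 < t" "t < 1" using S edge_iff by (auto simp: t_def)
      have v: "v = vert S + axis i t" by (simp add: S pt_def t_def)
      have vi: "v $ i = t" "\<And>j. j \<noteq> i \<Longrightarrow> v $ j = 0 \<or> v $ j = 1"
        using S(2) by (auto simp: v vert_def axis_def)
      have "a \<bullet> v = b" using t(1) by (simp add: v inner_add_right inner_vert inner_axis t_def)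
      moreover have "0 \<le> v $ j \<and> v $ j \<le> 1" for j
        using vi t by (cases "j = i") fastforce+
      ultimately show ?thesis using vi t by (auto simp: extreme_point_of_section_iff)
    qed
  qed
  have interior: "pt (S, i) $ i \<noteq> 0 \<and> pt (S, i) $ i \<noteq> 1 \<and> (\<forall>j. j \<noteq> i \<longrightarrow> pt (S, i) $ j = vert S $ j)"
    if "(S, i) \<in> ?E" for S i
    using that edge_iff[of i S] by (auto simp: pt_def vert_def axis_def)
  have vert01: "vert S $ j = 0 \<or> vert S $ j = 1" for S j by (simp add: vert_def)
  have "vert ` ?V \<inter> pt ` ?E = {}"
  proof (rule ccontr)
    assume "vert ` ?V \<inter> pt ` ?E \<noteq> {}"
    then obtain R S i where R: "vert R = pt (S, i)" and SE: "(S, i) \<in> ?E" by auto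
    then show False using interior[OF SE] vert01[of R i] by simp
  qed
  then have "card (vert ` ?V \<union> pt ` ?E) = card (vert ` ?V) + card (pt ` ?E)"
    by (intro card_Un_disjoint) auto
  also have "card (vert ` ?V) = card ?V"
    by (rule card_image) (rule inj_onI, rule vert_eqD, simp)
  also have "card (pt ` ?E) = card ?E"
  proof (rule card_image, rule inj_onI)
    fix p q assume p: "p \<in> ?E" and q: "q \<in> ?E" and eq: "pt p = pt q"
    obtain S i T k where pq: "p = (S, i)" "q = (T, k)" by (metis surj_pair)
    have ik: "i = k"
    proof (rule ccontr)
      assume "i \<noteq> k"
      then have "pt p $ i = vert T $ i" using interior[of T k] q pq eq by auto
      then show False using interior[of S i] p pq vert01[of T i] by auto
    qed
    have SE: "(S, i) \<in> ?E" and TE: "(T, i) \<in> ?E" using p q pq ik by auto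
    have "vert S $ j = vert T $ j" for j
    proof (cases "j = i")
      case True
      then show ?thesis using SE TE by (simp add: vert_def)
    next
      case False
      then have "vert S $ j = pt (S, i) $ j" "vert T $ j = pt (T, i) $ j"
        using interior[OF SE] interior[OF TE] by auto
      then show ?thesis using eq pq ik by simp
    qed
    then show "p = q" using ik pq vert_eqD by blast
  qed
  finally show ?thesis unfolding cv_def split section_count_def .
qed

text \<open>
  The hypothesis \<open>1 \<le> m\<close> makes the condition that the hyperplane meets the cube automatic, since
  a section with a vertex is nonempty.
\<close>

lemma cv_hypercube_attained_iff:
  assumes "1 \<le> m"
  shows "(\<exists>H \<in> meeting_hyperplanes (hypercube :: (real ^ 'n::finite) set). m = cv hypercube H)
    \<longleftrightarrow> m \<in> section_counts (UNIV :: 'n set)"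
proof
  assume "\<exists>H \<in> meeting_hyperplanes (hypercube :: (real ^ 'n) set). m = cv hypercube H"
  then obtain a :: "real ^ 'n" and b where "a \<noteq> 0" "m = cv hypercube {x. a \<bullet> x = b}"
    by (auto simp: meeting_hyperplanes_def affine_hyperplane_def)
  then show "m \<in> section_counts (UNIV :: 'n set)"
    by (auto simp: cv_hypercube vec_eq_iff section_counts_def)
next
  assume "m \<in> section_counts (UNIV :: 'n set)"
  then obtain w :: "'n \<Rightarrow> real" and b i where w: "w i \<noteq> 0" "section_count UNIV w b = m" by (auto simp: section_counts_def)
  define a :: "real ^ 'n" where "a = (\<chi> i. w i)"
  let ?H = "{x. a \<bullet> x = b}"
  have "a \<noteq> 0" using w(1) by (auto simp: a_def vec_eq_iff)
  then have H: "affine_hyperplane ?H" unfolding affine_hyperplane_def by blast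
  have m: "cv hypercube ?H = m" using w(2) by (simp add: cv_hypercube a_def)
  have "?H \<inter> hypercube \<noteq> {}"
  proof
    assume "?H \<inter> hypercube = {}"
    then have "cv hypercube ?H = 0" by (simp add: cv_def extreme_point_of_def)
    then show False using m assms by simp
  qed
  then show "\<exists>H \<in> meeting_hyperplanes (hypercube :: (real ^ 'n) set). m = cv hypercube H"
    using H m by (intro bexI[of _ ?H]) (auto simp: meeting_hyperplanes_def)
qed

text \<open>
  The maximum defining \<open>nu\<close> has its intended meaning only for a finite set of values; there are at
  most as many vertices as cube vertices and pairs \<open>(S, i)\<close> together.
\<close>

lemma cv_le_nu_hypercube:
  assumes "H \<in> meeting_hyperplanes (hypercube :: (real ^ 'n::finite) set)"
  shows "cv hypercube H \<le> nu (hypercube :: (real ^ 'n) set)"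
proof -
  have "cv hypercube K \<le> card (UNIV :: 'n set set) + card (UNIV :: ('n set \<times> 'n) set)"
    if "K \<in> meeting_hyperplanes (hypercube :: (real ^ 'n) set)" for K
  proof -
    have "affine_hyperplane K" using that by (simp add: meeting_hyperplanes_def)
    then obtain a :: "real ^ 'n" and b where "a \<noteq> 0 \<and> K = {x. a \<bullet> x = b}"
      unfolding affine_hyperplane_def by (elim exE)
    then have "K = {x. a \<bullet> x = b}" ..
    then show ?thesis
      by (simp only: cv_hypercube section_count_def) (intro add_mono card_mono subset_UNIV finite)
  qed
  then have "finite (cv hypercube ` meeting_hyperplanes (hypercube :: (real ^ 'n) set))"
    by (intro finite_subset[OF _ finite_atMost]) auto
  then show ?thesis unfolding nu_def using assms by (intro Max_ge) auto
qed

theorem theorem1p4: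
  fixes d m :: nat and I :: "nat set"
  defines "d \<equiv> CARD('n::finite)"
  defines "I \<equiv> {2 ^ i | i. i \<le> d - 1} \<union> {d, 2 * d - 2, 3 * d - 5, 3 * d - 4}"
  assumes "d \<ge> 4" and "1 \<le> m" and "m \<le> 4 * d - 10"
  shows "is_gap (hypercube :: (real ^ 'n) set) m \<longleftrightarrow> m \<notin> I"
proof -
  let ?Q = "hypercube :: (real ^ 'n) set"
  have card: "4 \<le> card (UNIV :: 'n set)" using assms(3) by (simp add: d_def)
  have I: "m \<in> I \<longleftrightarrow> (\<exists>k\<le>d - 1. m = 2 ^ k) \<or> m \<in> {d, 2 * d - 2, 3 * d - 5, 3 * d - 4}"
    unfolding I_def by blast
  have "m \<in> section_counts (UNIV :: 'n set) \<longleftrightarrow> m \<in> I"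
  proof
    assume "m \<in> section_counts (UNIV :: 'n set)"
    then obtain w b and i :: 'n where w: "w i \<noteq> 0" "section_count UNIV w b = m" by (auto simp: section_counts_def)
    have "\<not> 4 * d - 9 \<le> m" "m \<noteq> 0" using assms(3-5) by linarith+
    then show "m \<in> I"
      using section_count_values[where w = w and b = b, OF finite card UNIV_I w(1)]
      unfolding I w(2) d_def[symmetric] by simp
  next
    assume "m \<in> I"
    then show "m \<in> section_counts (UNIV :: 'n set)"
      using section_counts_attained[OF finite card, of m] unfolding I d_def by blast
  qed
  then have attained: "(\<exists>H\<in>meeting_hyperplanes ?Q. m = cv ?Q H) \<longleftrightarrow> m \<in> I"
    using cv_hypercube_attained_iff[OF assms(4), where 'n = 'n] by simp
  have "4 * d - 8 \<in> section_counts (UNIV :: 'n set)"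
    using section_counts_attained[OF finite card, of "4 * d - 8"] unfolding d_def by blast
  moreover have one_le: "1 \<le> 4 * d - 8" using assms(3) by linarith
  ultimately obtain H where "H \<in> meeting_hyperplanes ?Q" "4 * d - 8 = cv ?Q H"
    using cv_hypercube_attained_iff[OF one_le, where 'n = 'n] by blast
  then have "4 * d - 8 \<le> nu ?Q" using cv_le_nu_hypercube by metis
  then have "m \<le> nu ?Q" using assms(5) by linarith
  then show ?thesis unfolding is_gap_def attained using assms(4) by simp
qed

end
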